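(* For every relational algebra expression $e$, there exists a type formula that is principal for $e$, and such a principal type formula can be effectively computed from $e$.
   Context: Fix infinite supplies of relation variables, attribute names, and type variables. A type is a finite set of attribute names. For a finite set $S$ of relation variables, a type assignment on $S$ is a map $\mathcal{T}$ assigning to each $r\in S$ a type $\mathcal{T}(r)$. Relational algebra expressions are generated by the grammar $e \to r \mid (e\cup e)\mid (e-e)\mid (e\Join e)\mid (e\times e)\mid \sigma_{\theta(A_1,\ldots,A_n)}(e)\mid \pi_{A_1,\ldots,A_n}(e)\mid \rho_{A/B}(e)\mid \widehat{\pi}_A(e)$, where $r$ is a relation variable, $A,B,A_i$ are attribute names and $\theta$ is a selection predicate. ${\it Relvars}(e)$ is the set of relation variables occurring in $e$. Typing: for a type assignment $\mathcal{T}$ on a set containing ${\it Relvars}(e)$ and a type $\tau$, the judgment $\mathcal{T}\vdash e:\tau$ is defined inductively: $\mathcal{T}\vdash r:\mathcal{T}(r)$; if $\mathcal{T}\vdash e_1:\tau$ and $\mathcal{T}\vdash e_2:\tau$ then $\mathcal{T}\vdash (e_1\cup e_2):\tau$ and $\mathcal{T}\vdash(e_1-e_2):\tau$; if $\mathcal{T}\vdash e_1:\tau_1$ and $\mathcal{T}\vdash e_2:\tau_2$ then $\mathcal{T}\vdash (e_1\Join e_2):\tau_1\cup\tau_2$, and if moreover $\tau_1\cap\tau_2=\emptyset$ then $\mathcal{T}\vdash(e_1\times e_2):\tau_1\cup\tau_2$; if $\mathcal{T}\vdash e:\tau$ and $A_1,\ldots,A_n\in\tau$ then $\mathcal{T}\vdash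 \sigma_{\theta(A_1,\ldots,A_n)}(e):\tau$ and $\mathcal{T}\vdash\pi_{A_1,\ldots,A_n}(e):\{A_1,\ldots,A_n\}$; if $\mathcal{T}\vdash e:\tau$, $A\in\tau$, $B\notin\tau$ then $\mathcal{T}\vdash\rho_{A/B}(e):(\tau-\{A\})\cup\{B\}$; if $\mathcal{T}\vdash e:\tau$ and $A\in\tau$ then $\mathcal{T}\vdash\widehat{\pi}_A(e):\tau-\{A\}$. A type context $\Gamma$ consists of: a finite set ${\it Relvars}$ of relation variables; a finite set ${\it Typevars}$ of type variables; a map ${\it decl}:{\it Relvars}\to 2^{{\it Typevars}}$; a finite set ${\it Specattrs}$ of attribute names (special attributes); and a map ${\it constraint}$ assigning to each special attribute a propositional Boolean formula whose propositional variables are elements of ${\it Relvars}$. An instantiation of $\Gamma$ is a map $\mathcal{I}$ on ${\it Typevars}\cup{\it Specattrs}$ such that: each type variable $a$ is mapped to a type $\mathcal{I}(a)$, with $\mathcal{I}(a_1)\cap\mathcal{I}(a_2)=\emptyset$ for distinct type variables $a_1,a_2$ and $A\notin\mathcal{I}(a)$ for every type variable $a$ and special attribute $A$; and each special attribute $A$ is mapped to a subset $\mathcal{I}(A)\subseteq{\it Relvars}$ such that the truth assignment making exactly the variables in $\mathcal{I}(A)$ true satisfies ${\it constraint}(A)$ (written $\mathcal{I}(A)\models{\it constraint}(A)$). The image $\mathcal{I}(\Gamma)$ is the type assignment on ${\it Relvars}$ with $\mathcal{I}(\Gamma)(r)=\bigcup\{\mathcal{I}(a)\mid a\in{\it decl}(r)\}\cup\{A\in{\it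 Specattrs}\mid r\in\mathcal{I}(A)\}$. A type formula is a quadruple $(\Gamma,e,{\it Outvars},{\it outatt})$ where $\Gamma$ is a type context, $e$ is an expression with ${\it Relvars}(e)={\it Relvars}(\Gamma)$ and ${\it Specattrs}(\Gamma)$ containing every attribute name explicitly occurring in $e$, ${\it Outvars}\subseteq{\it Typevars}(\Gamma)$, and ${\it outatt}$ assigns to each special attribute a Boolean formula over ${\it Relvars}(\Gamma)$. For an instantiation $\mathcal{I}$ of $\Gamma$, the output type of the type formula under $\mathcal{I}$ is $\bigcup\{\mathcal{I}(a)\mid a\in{\it Outvars}\}\cup\{A\in{\it Specattrs}\mid \mathcal{I}(A)\models{\it outatt}(A)\}$. A type formula $(\Gamma,e,{\it Outvars},{\it outatt})$ is principal for $e$ if for every type assignment $\mathcal{T}$ on ${\it Relvars}(e)$ and every type $\tau$: $\mathcal{T}\vdash e:\tau$ holds if and only if there is an instantiation $\mathcal{I}$ of $\Gamma$ with $\mathcal{I}(\Gamma)=\mathcal{T}$ and with $\tau$ equal to the output type of the type formula under $\mathcal{I}$. (In particular, if $e$ is well-typed under no type assignment, any type formula whose type context has no instantiation is principal for $e$.) *)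

theory Defs
  imports Main "HOL-Library.Nat_Bijection"
begin

section \<open>Relational algebra expressions\<close>

text \<open>Each of the infinite supplies of names is a copy of the natural numbers, so that
  expressions and type formulas are finite objects over an effectively enumerated alphabet.
  Typing never looks inside a selection predicate, so only its name is kept.\<close>

type_synonym relvar = nat
type_synonym attr = nat
type_synonym tvar = nat
type_synonym selpred = nat

datatype expr =
    Relvar relvar
  | Cup expr expr
  | Minus expr expr
  | NatJoin expr expr
  | Product expr expr
  | Select selpred "attr list" expr
  | Project "attr list" expr
  | Rename attr attr expr  \<comment> \<open>\<open>Rename A B e\<close> is \<open>\<rho>\<close> with subscript \<open>A/B\<close>: \<open>A\<close> becomes \<open>B\<close>\<close>
  | ProjectAway attr expr

fun expr_relvars :: "expr \<Rightarrow> relvar set" where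
  "expr_relvars (Relvar r) = {r}"
| "expr_relvars (Cup e1 e2) = expr_relvars e1 \<union> expr_relvars e2"
| "expr_relvars (Minus e1 e2) = expr_relvars e1 \<union> expr_relvars e2"
| "expr_relvars (NatJoin e1 e2) = expr_relvars e1 \<union> expr_relvars e2"
| "expr_relvars (Product e1 e2) = expr_relvars e1 \<union> expr_relvars e2"
| "expr_relvars (Select \<theta> As e) = expr_relvars e"
| "expr_relvars (Project As e) = expr_relvars e"
| "expr_relvars (Rename A B e) = expr_relvars e"
| "expr_relvars (ProjectAway A e) = expr_relvars e"

fun expr_attrs :: "expr \<Rightarrow> attr set" where
  "expr_attrs (Relvar r) = {}"
| "expr_attrs (Cup e1 e2) = expr_attrs e1 \<union> expr_attrs e2"
| "expr_attrs (Minus e1 e2) = expr_attrs e1 \<union> expr_attrs e2"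
| "expr_attrs (NatJoin e1 e2) = expr_attrs e1 \<union> expr_attrs e2"
| "expr_attrs (Product e1 e2) = expr_attrs e1 \<union> expr_attrs e2"
| "expr_attrs (Select \<theta> As e) = set As \<union> expr_attrs e"
| "expr_attrs (Project As e) = set As \<union> expr_attrs e"
| "expr_attrs (Rename A B e) = {A, B} \<union> expr_attrs e"
| "expr_attrs (ProjectAway A e) = {A} \<union> expr_attrs e"

text \<open>A type assignment on a set \<open>S\<close> is a total function of which only the values on \<open>S\<close> matter;
  the other maps on finite sets of names below are treated in the same way.\<close>

definition type_assignment_on :: "relvar set \<Rightarrow> (relvar \<Rightarrow> attr set) \<Rightarrow> bool" where
  "type_assignment_on S T \<longleftrightarrow> (\<forall>r\<in>S. finite (T r))"

inductive has_type :: "(relvar \<Rightarrow> attr set) \<Rightarrow> expr \<Rightarrow> attr set \<Rightarrow> bool"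
    (\<open>(_ \<turnstile> _ : _)\<close> [51, 51, 51] 50)
  for T :: "relvar \<Rightarrow> attr set" where
  ty_Relvar: "T \<turnstile> Relvar r : T r"
| ty_Cup: "T \<turnstile> e1 : \<tau> \<Longrightarrow> T \<turnstile> e2 : \<tau> \<Longrightarrow> T \<turnstile> Cup e1 e2 : \<tau>"
| ty_Minus: "T \<turnstile> e1 : \<tau> \<Longrightarrow> T \<turnstile> e2 : \<tau> \<Longrightarrow> T \<turnstile> Minus e1 e2 : \<tau>"
| ty_NatJoin: "T \<turnstile> e1 : \<tau>1 \<Longrightarrow> T \<turnstile> e2 : \<tau>2 \<Longrightarrow> T \<turnstile> NatJoin e1 e2 : (\<tau>1 \<union> \<tau>2)"
| ty_Product: "T \<turnstile> e1 : \<tau>1 \<Longrightarrow> T \<turnstile> e2 : \<tau>2 \<Longrightarrow> \<tau>1 \<inter> \<tau>2 = {} \<Longrightarrow>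
    T \<turnstile> Product e1 e2 : (\<tau>1 \<union> \<tau>2)"
| ty_Select: "T \<turnstile> e : \<tau> \<Longrightarrow> set As \<subseteq> \<tau> \<Longrightarrow> T \<turnstile> Select \<theta> As e : \<tau>"
| ty_Project: "T \<turnstile> e : \<tau> \<Longrightarrow> set As \<subseteq> \<tau> \<Longrightarrow> T \<turnstile> Project As e : set As"
| ty_Rename: "T \<turnstile> e : \<tau> \<Longrightarrow> A \<in> \<tau> \<Longrightarrow> B \<notin> \<tau> \<Longrightarrow> T \<turnstile> Rename A B e : ((\<tau> - {A}) \<union> {B})"
| ty_ProjectAway: "T \<turnstile> e : \<tau> \<Longrightarrow> A \<in> \<tau> \<Longrightarrow> T \<turnstile> ProjectAway A e : (\<tau> - {A})"


section \<open>Type formulas\<close>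

datatype bform =
    FalseF
  | TrueF
  | VarF relvar
  | NotF bform
  | AndF bform bform
  | OrF bform bform

fun bform_vars :: "bform \<Rightarrow> relvar set" where
  "bform_vars FalseF = {}"
| "bform_vars TrueF = {}"
| "bform_vars (VarF r) = {r}"
| "bform_vars (NotF p) = bform_vars p"
| "bform_vars (AndF p q) = bform_vars p \<union> bform_vars q"
| "bform_vars (OrF p q) = bform_vars p \<union> bform_vars q"

text \<open>A truth assignment is given by the set of variables it makes true.\<close>

fun satisfies :: "relvar set \<Rightarrow> bform \<Rightarrow> bool" where
  "satisfies M FalseF \<longleftrightarrow> False"
| "satisfies M TrueF \<longleftrightarrow> True"
| "satisfies M (VarF r) \<longleftrightarrow> r \<in> M"
| "satisfies M (NotF p) \<longleftrightarrow> \<not> satisfies M p"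
| "satisfies M (AndF p q) \<longleftrightarrow> satisfies M p \<and> satisfies M q"
| "satisfies M (OrF p q) \<longleftrightarrow> satisfies M p \<or> satisfies M q"

record type_context =
  Relvars :: "relvar set"
  Typevars :: "tvar set"
  decl :: "relvar \<Rightarrow> tvar set"
  Specattrs :: "attr set"
  constraint :: "attr \<Rightarrow> bform"

definition is_type_context :: "type_context \<Rightarrow> bool" where
  "is_type_context \<Gamma> \<longleftrightarrow>
     finite (Relvars \<Gamma>) \<and> finite (Typevars \<Gamma>) \<and> finite (Specattrs \<Gamma>) \<and>
     (\<forall>r\<in>Relvars \<Gamma>. decl \<Gamma> r \<subseteq> Typevars \<Gamma>) \<and>
     (\<forall>A\<in>Specattrs \<Gamma>. bform_vars (constraint \<Gamma> A) \<subseteq> Relvars \<Gamma>)"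

text \<open>An instantiation has two components because type variables and attribute names,
  although both natural numbers here, are different sorts of names.\<close>

record type_inst =
  on_tvar :: "tvar \<Rightarrow> attr set"
  on_attr :: "attr \<Rightarrow> relvar set"

definition is_instantiation :: "type_context \<Rightarrow> type_inst \<Rightarrow> bool" where
  "is_instantiation \<Gamma> I \<longleftrightarrow>
     (\<forall>a\<in>Typevars \<Gamma>. finite (on_tvar I a)) \<and>
     (\<forall>a\<in>Typevars \<Gamma>. \<forall>b\<in>Typevars \<Gamma>. a \<noteq> b \<longrightarrow> on_tvar I a \<inter> on_tvar I b = {}) \<and>
     (\<forall>a\<in>Typevars \<Gamma>. \<forall>A\<in>Specattrs \<Gamma>. A \<notin> on_tvar I a) \<and>
     (\<forall>A\<in>Specattrs \<Gamma>. on_attr I A \<subseteq> Relvars \<Gamma> \<and> satisfies (on_attr I A) (constraint \<Gamma> A))"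

definition inst_image :: "type_context \<Rightarrow> type_inst \<Rightarrow> relvar \<Rightarrow> attr set" where
  "inst_image \<Gamma> I r =
     (\<Union>a\<in>decl \<Gamma> r. on_tvar I a) \<union> {A \<in> Specattrs \<Gamma>. r \<in> on_attr I A}"

record type_formula =
  context_of :: type_context
  expr_of :: expr
  Outvars :: "tvar set"
  outatt :: "attr \<Rightarrow> bform"

definition is_type_formula :: "type_formula \<Rightarrow> bool" where
  "is_type_formula \<phi> \<longleftrightarrow>
     is_type_context (context_of \<phi>) \<and>
     expr_relvars (expr_of \<phi>) = Relvars (context_of \<phi>) \<and>
     expr_attrs (expr_of \<phi>) \<subseteq> Specattrs (context_of \<phi>) \<and>
     Outvars \<phi> \<subseteq> Typevars (context_of \<phi>) \<and>
     (\<forall>A\<in>Specattrs (context_of \<phi>). bform_vars (outatt \<phi> A) \<subseteq> Relvars (context_of \<phi>))"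

definition output_type :: "type_formula \<Rightarrow> type_inst \<Rightarrow> attr set" where
  "output_type \<phi> I =
     (\<Union>a\<in>Outvars \<phi>. on_tvar I a) \<union>
     {A \<in> Specattrs (context_of \<phi>). satisfies (on_attr I A) (outatt \<phi> A)}"

definition principal_for :: "type_formula \<Rightarrow> expr \<Rightarrow> bool" where
  "principal_for \<phi> e \<longleftrightarrow>
     is_type_formula \<phi> \<and> expr_of \<phi> = e \<and>
     (\<forall>T \<tau>. type_assignment_on (expr_relvars e) T \<longrightarrow> finite \<tau> \<longrightarrow>
        (T \<turnstile> e : \<tau> \<longleftrightarrow>
          (\<exists>I. is_instantiation (context_of \<phi>) I \<and>
               (\<forall>r\<in>Relvars (context_of \<phi>). inst_image (context_of \<phi>) I r = T r) \<and>
               \<tau> = output_type \<phi> I)))"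


section \<open>Effective computability\<close>

text \<open>Partial recursive functions in the sense of Kleene: \<open>recf_eval f xs y\<close> says that the
  program \<open>f\<close> halts on the argument tuple \<open>xs\<close> with value \<open>y\<close>. Primitive recursion runs
  over the first argument.\<close>

datatype recf =
    Zero
  | Succ
  | Proj nat
  | Comp recf "recf list"
  | PrimRec recf recf
  | Mu recf

inductive recf_eval :: "recf \<Rightarrow> nat list \<Rightarrow> nat \<Rightarrow> bool" where
  ev_Zero: "recf_eval Zero xs 0"
| ev_Succ: "recf_eval Succ [x] (Suc x)"
| ev_Proj: "i < length xs \<Longrightarrow> recf_eval (Proj i) xs (xs ! i)"
| ev_Comp: "list_all2 (\<lambda>g y. recf_eval g xs y) gs ys \<Longrightarrow> recf_eval f ys z \<Longrightarrow>
    recf_eval (Comp f gs) xs z"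
| ev_PrimRec_0: "recf_eval f xs y \<Longrightarrow> recf_eval (PrimRec f g) (0 # xs) y"
| ev_PrimRec_Suc: "recf_eval (PrimRec f g) (n # xs) y \<Longrightarrow> recf_eval g (n # y # xs) z \<Longrightarrow>
    recf_eval (PrimRec f g) (Suc n # xs) z"
| ev_Mu: "recf_eval f (n # xs) 0 \<Longrightarrow> \<forall>m<n. \<exists>k. recf_eval f (m # xs) (Suc k) \<Longrightarrow>
    recf_eval (Mu f) xs n"

inductive_cases recf_eval_elims:
  "recf_eval Zero xs z" "recf_eval Succ xs z" "recf_eval (Proj i) xs z"
  "recf_eval (Comp f gs) xs z" "recf_eval (PrimRec f g) (0 # xs) z"
  "recf_eval (PrimRec f g) (Suc n # xs) z" "recf_eval (Mu f) xs z"

lemma recf_eval_deterministic: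
  "recf_eval f xs y \<Longrightarrow> recf_eval f xs z \<Longrightarrow> y = z"
proof (induction arbitrary: z rule: recf_eval.induct)
  case (ev_Comp xs gs ys f y)
  from ev_Comp.prems obtain ys' where
    ys': "list_all2 (\<lambda>g y. recf_eval g xs y) gs ys'" "recf_eval f ys' z"
    by (rule recf_eval_elims)
  have "ys = ys'"
    using ev_Comp.IH(1) ys'(1) by (auto simp: list_all2_conv_all_nth intro!: nth_equalityI)
  then show ?case using ev_Comp.IH(2) ys'(2) by blast
next
  case (ev_Mu f n xs)
  from ev_Mu.prems have "recf_eval f (z # xs) 0 \<and> (\<forall>m<z. \<exists>k. recf_eval f (m # xs) (Suc k))"
    by (rule recf_eval_elims) (rule conjI)
  then have z: "recf_eval f (z # xs) 0" "\<forall>m<z. \<exists>k. recf_eval f (m # xs) (Suc k)"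
    by blast+
  show ?case
  proof (rule linorder_cases[of n z])
    assume "n < z"
    then obtain k where "recf_eval f (n # xs) (Suc k)" using z(2) by blast
    then show ?thesis using ev_Mu.IH(1)[of "Suc k"] by simp
  next
    assume "z < n"
    then obtain k where "\<And>w. recf_eval f (z # xs) w \<Longrightarrow> Suc k = w" using ev_Mu.IH(2) by blast
    from this[OF z(1)] show ?thesis by simp
  qed simp
next
  case (ev_PrimRec_0 f xs y g)
  from ev_PrimRec_0.prems have "recf_eval f xs z" by (rule recf_eval_elims)
  then show ?case by (rule ev_PrimRec_0.IH)
next
  case (ev_PrimRec_Suc f g n xs y z')
  from ev_PrimRec_Suc.prems obtain y' where
    y': "recf_eval (PrimRec f g) (n # xs) y'" "recf_eval g (n # y' # xs) z"
    by (rule recf_eval_elims)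
  then show ?case using ev_PrimRec_Suc.IH by blast
qed (erule recf_eval_elims; simp)+

fun expr_encode :: "expr \<Rightarrow> nat" where
  "expr_encode (Relvar r) = prod_encode (0, r)"
| "expr_encode (Cup e1 e2) = prod_encode (1, prod_encode (expr_encode e1, expr_encode e2))"
| "expr_encode (Minus e1 e2) = prod_encode (2, prod_encode (expr_encode e1, expr_encode e2))"
| "expr_encode (NatJoin e1 e2) = prod_encode (3, prod_encode (expr_encode e1, expr_encode e2))"
| "expr_encode (Product e1 e2) = prod_encode (4, prod_encode (expr_encode e1, expr_encode e2))"
| "expr_encode (Select \<theta> As e) =
     prod_encode (5, prod_encode (prod_encode (\<theta>, list_encode As), expr_encode e))"
| "expr_encode (Project As e) = prod_encode (6, prod_encode (list_encode As, expr_encode e))"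
| "expr_encode (Rename A B e) =
     prod_encode (7, prod_encode (prod_encode (A, B), expr_encode e))"
| "expr_encode (ProjectAway A e) = prod_encode (8, prod_encode (A, expr_encode e))"

lemma expr_encode_eq [simp]: "expr_encode e = expr_encode e' \<longleftrightarrow> e = e'"
proof
  show "expr_encode e = expr_encode e' \<Longrightarrow> e = e'"
    by (induction e arbitrary: e') (case_tac e'; auto simp: list_encode_eq)+
qed simp

fun bform_encode :: "bform \<Rightarrow> nat" where
  "bform_encode FalseF = prod_encode (0, 0)"
| "bform_encode TrueF = prod_encode (1, 0)"
| "bform_encode (VarF r) = prod_encode (2, r)"
| "bform_encode (NotF p) = prod_encode (3, bform_encode p)"
| "bform_encode (AndF p q) = prod_encode (4, prod_encode (bform_encode p, bform_encode q))"
| "bform_encode (OrF p q) = prod_encode (5, prod_encode (bform_encode p, bform_encode q))"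

lemma bform_encode_eq [simp]: "bform_encode p = bform_encode q \<longleftrightarrow> p = q"
proof
  show "bform_encode p = bform_encode q \<Longrightarrow> p = q"
    by (induction p arbitrary: q) (case_tac q; auto)+
qed simp

text \<open>A natural number represents a type formula if it codes explicit finite listings of all its
  components. The order of a listing, and repetitions in it, are immaterial, so a type formula has
  many codes; but a code determines the type formula, up to the irrelevant values of maps outside
  their domains.\<close>

definition represents :: "nat \<Rightarrow> type_formula \<Rightarrow> bool" where
  "represents c \<phi> \<longleftrightarrow>
     (\<exists>(ds :: (relvar \<times> tvar list) list) (ts :: tvar list)
        (ss :: (attr \<times> bform \<times> bform) list) (os :: tvar list).
       c = list_encode
             [list_encode (map (\<lambda>(r, as). prod_encode (r, list_encode as)) ds),
              list_encode ts,
              list_encode (map (\<lambda>(A, p, q).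
                prod_encode (A, prod_encode (bform_encode p, bform_encode q))) ss),
              expr_encode (expr_of \<phi>),
              list_encode os] \<and>
       Relvars (context_of \<phi>) = fst ` set ds \<and>
       (\<forall>(r, as)\<in>set ds. decl (context_of \<phi>) r = set as) \<and>
       Typevars (context_of \<phi>) = set ts \<and>
       Specattrs (context_of \<phi>) = fst ` set ss \<and>
       (\<forall>(A, p, q)\<in>set ss. constraint (context_of \<phi>) A = p \<and> outatt \<phi> A = q) \<and>
       Outvars \<phi> = set os)"

lemma is_type_formula_imp_represents:
  assumes "is_type_formula \<phi>"
  shows "\<exists>c. represents c \<phi>"
proof -
  let ?\<Gamma> = "context_of \<phi>"
  have fin: "finite (Relvars ?\<Gamma>)" "finite (Typevars ?\<Gamma>)" "finite (Specattrs ?\<Gamma>)"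
    "finite (Outvars \<phi>)"
    using assms by (auto simp: is_type_formula_def is_type_context_def intro: finite_subset)
  obtain rs where rs: "set rs = Relvars ?\<Gamma>" using finite_list[OF fin(1)] ..
  obtain ts where ts: "set ts = Typevars ?\<Gamma>" using finite_list[OF fin(2)] ..
  obtain As where As: "set As = Specattrs ?\<Gamma>" using finite_list[OF fin(3)] ..
  obtain os where os: "set os = Outvars \<phi>" using finite_list[OF fin(4)] ..
  have "finite (decl ?\<Gamma> r)" if "r \<in> Relvars ?\<Gamma>" for r
    using assms that fin(2) by (auto simp: is_type_formula_def is_type_context_def intro: finite_subset)
  then have "\<forall>r\<in>Relvars ?\<Gamma>. \<exists>as. set as = decl ?\<Gamma> r"
    by (simp add: finite_list)
  from bchoice[OF this] obtain d where d: "\<And>r. r \<in> Relvars ?\<Gamma> \<Longrightarrow> set (d r) = decl ?\<Gamma> r"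
    by blast
  let ?ds = "map (\<lambda>r. (r, d r)) rs"
  let ?ss = "map (\<lambda>A. (A, constraint ?\<Gamma> A, outatt \<phi> A)) As"
  show ?thesis
    unfolding represents_def
  proof (rule exI, rule exI[of _ ?ds], rule exI[of _ ts], rule exI[of _ ?ss],
      rule exI[of _ os], intro conjI, rule refl)
    show "Relvars ?\<Gamma> = fst ` set ?ds" by (simp add: rs image_image)
    show "\<forall>(r, as)\<in>set ?ds. decl ?\<Gamma> r = set as" by (simp add: rs d)
    show "Typevars ?\<Gamma> = set ts" by (simp add: ts)
    show "Specattrs ?\<Gamma> = fst ` set ?ss" by (simp add: As image_image)
    show "\<forall>(A, p, q)\<in>set ?ss. constraint ?\<Gamma> A = p \<and> outatt \<phi> A = q" by simp
    show "Outvars \<phi> = set os" by (simp add: os)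
  qed
qed

lemma represents_unique:
  assumes "represents c \<phi>" "represents c \<psi>"
  shows "Relvars (context_of \<phi>) = Relvars (context_of \<psi>)"
    and "Typevars (context_of \<phi>) = Typevars (context_of \<psi>)"
    and "Specattrs (context_of \<phi>) = Specattrs (context_of \<psi>)"
    and "expr_of \<phi> = expr_of \<psi>"
    and "Outvars \<phi> = Outvars \<psi>"
    and "r \<in> Relvars (context_of \<phi>) \<Longrightarrow> decl (context_of \<phi>) r = decl (context_of \<psi>) r"
    and "A \<in> Specattrs (context_of \<phi>) \<Longrightarrow>
      constraint (context_of \<phi>) A = constraint (context_of \<psi>) A \<and> outatt \<phi> A = outatt \<psi> A"
proof -
  have "inj (\<lambda>(r, as). prod_encode (r, list_encode as))"
    by (auto simp: inj_def list_encode_eq)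
  note ds_inj = inj_map_eq_map[OF this]
  have "inj (\<lambda>(A, p, q). prod_encode (A, prod_encode (bform_encode p, bform_encode q)))"
    by (auto simp: inj_def)
  note ss_inj = inj_map_eq_map[OF this]
  from assms(1) obtain ds ts ss os where l:
    "c = list_encode
       [list_encode (map (\<lambda>(r, as). prod_encode (r, list_encode as)) ds),
        list_encode ts,
        list_encode (map (\<lambda>(A, p, q).
          prod_encode (A, prod_encode (bform_encode p, bform_encode q))) ss),
        expr_encode (expr_of \<phi>),
        list_encode os]"
    "Relvars (context_of \<phi>) = fst ` set ds"
    "\<forall>(r, as)\<in>set ds. decl (context_of \<phi>) r = set as"
    "Typevars (context_of \<phi>) = set ts"
    "Specattrs (context_of \<phi>) = fst ` set ss"
    "\<forall>(A, p, q)\<in>set ss. constraint (context_of \<phi>) A = p \<and> outatt \<phi> A = q"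
    "Outvars \<phi> = set os"
    unfolding represents_def by (elim exE conjE) (rule that)
  from assms(2) obtain ds' ts' ss' os' where l':
    "c = list_encode
       [list_encode (map (\<lambda>(r, as). prod_encode (r, list_encode as)) ds'),
        list_encode ts',
        list_encode (map (\<lambda>(A, p, q).
          prod_encode (A, prod_encode (bform_encode p, bform_encode q))) ss'),
        expr_encode (expr_of \<psi>),
        list_encode os']"
    "Relvars (context_of \<psi>) = fst ` set ds'"
    "\<forall>(r, as)\<in>set ds'. decl (context_of \<psi>) r = set as"
    "Typevars (context_of \<psi>) = set ts'"
    "Specattrs (context_of \<psi>) = fst ` set ss'"
    "\<forall>(A, p, q)\<in>set ss'. constraint (context_of \<psi>) A = p \<and> outatt \<psi> A = q"
    "Outvars \<psi> = set os'"
    unfolding represents_def by (elim exE conjE) (rule that)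
  have eqs: "ds' = ds" "ts' = ts" "ss' = ss" "os' = os" "expr_of \<psi> = expr_of \<phi>"
    using l(1) unfolding l'(1)
    by (simp_all only: list_encode_eq list.inject ds_inj ss_inj expr_encode_eq)
  note l' = l'(2-)[unfolded eqs]
  show "Relvars (context_of \<phi>) = Relvars (context_of \<psi>)"
    "Typevars (context_of \<phi>) = Typevars (context_of \<psi>)"
    "Specattrs (context_of \<phi>) = Specattrs (context_of \<psi>)"
    "expr_of \<phi> = expr_of \<psi>" "Outvars \<phi> = Outvars \<psi>"
    by (simp_all add: l l' eqs)
  show "decl (context_of \<phi>) r = decl (context_of \<psi>) r" if "r \<in> Relvars (context_of \<phi>)"
  proof -
    from that obtain as where "(r, as) \<in> set ds" by (auto simp: l(2))
    then show ?thesis using bspec[OF l(3)] bspec[OF l'(2)] by fastforce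
  qed
  show "constraint (context_of \<phi>) A = constraint (context_of \<psi>) A \<and> outatt \<phi> A = outatt \<psi> A"
    if "A \<in> Specattrs (context_of \<phi>)"
  proof -
    from that obtain p q where "(A, p, q) \<in> set ss" by (auto simp: l(5))
    then show ?thesis using bspec[OF l(6)] bspec[OF l'(5)] by fastforce
  qed
qed

definition effectively_computable :: "(expr \<Rightarrow> type_formula) \<Rightarrow> bool" where
  "effectively_computable F \<longleftrightarrow>
     (\<exists>p. \<forall>e. \<exists>c. recf_eval p [expr_encode e] c \<and> represents c (F e))"

end

theory Submission
  imports Defs
begin

text \<open>Typing treats the attributes independently of each other. Membership of an attribute \<open>X\<close> in the
  type of \<open>e\<close>, and the requirements imposed on \<open>X\<close> by well-typedness, are Boolean formulas over the
  relation variables, evaluated at the set of relation variables having \<open>X\<close> in their type; the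
  formulas are the same for all \<open>X\<close> not named in \<open>e\<close>. The special attributes are the numbers
  up to the code of \<open>e\<close>, among them those named in \<open>e\<close>, with these formulas as \<open>outatt\<close> and
  constraint. For the other attributes one takes a type variable for each set of relation variables
  that meets the requirements, and decides by the membership formula whether
  it belongs to \<open>Outvars\<close>. No unification is needed, at the price of exponentially many type
  variables. All of this is primitive recursive on codes, by course-of-values recursion.\<close>

section \<open>Total recursive functions\<close>

definition total_recursive :: "nat \<Rightarrow> (nat list \<Rightarrow> nat) \<Rightarrow> bool" where
  "total_recursive k f \<longleftrightarrow> (\<exists>p. \<forall>xs. length xs = k \<longrightarrow> recf_eval p xs (f xs))"

named_theorems total_recursive_intros

lemma total_recursive_nth [total_recursive_intros]:
  "i < k \<Longrightarrow> total_recursive k (\<lambda>xs. xs ! i)"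
  unfolding total_recursive_def by (intro exI[of _ "Proj i"]) (auto intro: ev_Proj)

text \<open>\<open>total_recursive_rec_nat\<close> hands the parameters to the step function as
  \<open>drop 2 ys\<close>, so projections out of a tail must be recognised too.\<close>

lemma total_recursive_drop_nth [total_recursive_intros]:
  "j + i < k \<Longrightarrow> total_recursive k (\<lambda>xs. drop j xs ! i)"
  unfolding total_recursive_def
proof (intro exI[of _ "Proj (j + i)"] allI impI)
  fix xs :: "nat list" assume "j + i < k" "length xs = k"
  then show "recf_eval (Proj (j + i)) xs (drop j xs ! i)"
    using ev_Proj[of "j + i" xs] by simp
qed

lemma total_recursive_compose:
  assumes F: "total_recursive (length gs) F"
    and gs: "\<And>g. g \<in> set gs \<Longrightarrow> total_recursive k g"
  shows "total_recursive k (\<lambda>xs. F (map (\<lambda>g. g xs) gs))"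
proof -
  obtain p where p: "\<And>ys. length ys = length gs \<Longrightarrow> recf_eval p ys (F ys)"
    using F unfolding total_recursive_def by blast
  have "\<forall>g\<in>set gs. \<exists>q. \<forall>xs. length xs = k \<longrightarrow> recf_eval q xs (g xs)"
    using gs unfolding total_recursive_def by blast
  then obtain q where q: "\<And>g xs. g \<in> set gs \<Longrightarrow> length xs = k \<Longrightarrow> recf_eval (q g) xs (g xs)"
    by metis
  have "recf_eval (Comp p (map q gs)) xs (F (map (\<lambda>g. g xs) gs))" if "length xs = k" for xs
    by (rule ev_Comp[where ys = "map (\<lambda>g. g xs) gs"])
      (auto simp: list_all2_conv_all_nth that intro!: p q)
  then show ?thesis unfolding total_recursive_def by blast
qed

lemma total_recursive_compose1:
  assumes "total_recursive 1 (\<lambda>xs. F (xs ! 0))" "total_recursive k f"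
  shows "total_recursive k (\<lambda>xs. F (f xs))"
  using total_recursive_compose[of "[f]" "\<lambda>xs. F (xs ! 0)" k] assms by simp

lemma total_recursive_compose2:
  assumes "total_recursive 2 (\<lambda>xs. F (xs ! 0) (xs ! 1))" "total_recursive k f" "total_recursive k g"
  shows "total_recursive k (\<lambda>xs. F (f xs) (g xs))"
  using total_recursive_compose[of "[f, g]" "\<lambda>xs. F (xs ! 0) (xs ! 1)" k] assms
  by (auto simp: numeral_2_eq_2)

lemma total_recursive_compose3:
  assumes "total_recursive 3 (\<lambda>xs. F (xs ! 0) (xs ! 1) (xs ! 2))"
    "total_recursive k f" "total_recursive k g" "total_recursive k h"
  shows "total_recursive k (\<lambda>xs. F (f xs) (g xs) (h xs))"
  using total_recursive_compose[of "[f, g, h]" "\<lambda>xs. F (xs ! 0) (xs ! 1) (xs ! 2)" k] assms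
  by (auto simp: numeral_2_eq_2 numeral_3_eq_3)

lemma total_recursive_Suc [total_recursive_intros]:
  "total_recursive k f \<Longrightarrow> total_recursive k (\<lambda>xs. Suc (f xs))"
proof (rule total_recursive_compose1[where F = Suc])
  show "total_recursive 1 (\<lambda>xs. Suc (xs ! 0))"
    unfolding total_recursive_def
    by (intro exI[of _ Succ]) (auto simp: length_Suc_conv intro: ev_Succ)
qed

lemma total_recursive_const [total_recursive_intros]: "total_recursive k (\<lambda>_. c)"
proof (induction c)
  case 0
  show ?case unfolding total_recursive_def by (blast intro: ev_Zero)
qed (rule total_recursive_Suc)

lemma total_recursive_rec_nat [total_recursive_intros]:
  assumes b: "total_recursive k b" and n: "total_recursive k n"
    and g: "total_recursive (Suc (Suc k)) (\<lambda>ys. g (ys ! 0) (ys ! 1) (drop 2 ys))"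
  shows "total_recursive k (\<lambda>xs. rec_nat (b xs) (\<lambda>i y. g i y xs) (n xs))"
proof -
  obtain p where p: "\<And>xs. length xs = k \<Longrightarrow> recf_eval p xs (b xs)"
    using b unfolding total_recursive_def by blast
  obtain q where q: "\<And>ys. length ys = Suc (Suc k) \<Longrightarrow> recf_eval q ys (g (ys ! 0) (ys ! 1) (drop 2 ys))"
    using g unfolding total_recursive_def by blast
  have "recf_eval (PrimRec p q) (m # xs) (rec_nat (b xs) (\<lambda>i y. g i y xs) m)"
    if "length xs = k" for m xs
  proof (induction m)
    case 0
    show ?case using p[OF that] by (auto intro: ev_PrimRec_0)
  next
    case (Suc m)
    from Suc show ?case
      using q[of "m # rec_nat (b xs) (\<lambda>i y. g i y xs) m # xs"] that
      by (auto intro: ev_PrimRec_Suc)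
  qed
  then have "total_recursive (Suc k)
      (\<lambda>ys. rec_nat (b (tl ys)) (\<lambda>i y. g i y (tl ys)) (hd ys))" (is "total_recursive _ ?F")
    unfolding total_recursive_def
    by (intro exI[of _ "PrimRec p q"]) (auto simp: length_Suc_conv)
  \<comment> \<open>\<open>PrimRec\<close> expects the recursion count in front of the parameters,
    so it is composed with \<open>n\<close> followed by all \<open>k\<close> projections.\<close>
  then have "total_recursive k
      (\<lambda>xs. ?F (map (\<lambda>g. g xs) (n # map (\<lambda>i xs. xs ! i) [0..<k])))"
    by (intro total_recursive_compose) (auto simp: n intro: total_recursive_nth)
  moreover have "map (\<lambda>i. xs ! i) [0..<k] = xs" if "length xs = k" for xs :: "nat list"
    using that map_nth by blast
  ultimately show ?thesis
    unfolding total_recursive_def by (auto simp: comp_def)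
qed

subsection \<open>Arithmetic\<close>

lemma total_recursive_add [total_recursive_intros]:
  assumes "total_recursive k f" "total_recursive k g"
  shows "total_recursive k (\<lambda>xs. f xs + g xs)"
proof -
  have eq: "m + n = rec_nat m (\<lambda>_ y. Suc y) n" for m n :: nat by (induction n) auto
  show ?thesis unfolding eq by (intro total_recursive_intros assms) simp
qed

lemma total_recursive_diff [total_recursive_intros]:
  assumes "total_recursive k f" "total_recursive k g"
  shows "total_recursive k (\<lambda>xs. f xs - g xs)"
proof -
  have pred: "rec_nat 0 (\<lambda>i _. i) n = n - 1" for n :: nat by (cases n) auto
  have eq: "m - n = rec_nat m (\<lambda>_ y. rec_nat 0 (\<lambda>i _. i) y) n" for m n :: nat
    by (induction n) (auto simp: pred)
  show ?thesis unfolding eq by (intro total_recursive_intros assms) simp_all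
qed

lemma total_recursive_if_eq [total_recursive_intros]:
  assumes "total_recursive k p" "total_recursive k q" "total_recursive k f" "total_recursive k g"
  shows "total_recursive k (\<lambda>xs. if p xs = q xs then f xs else g xs)"
proof -
  \<comment> \<open>Proved for projections first, because arbitrary arguments would reappear in the
    step function applied to \<open>drop 2 ys\<close>.\<close>
  have "total_recursive 3 (\<lambda>xs. rec_nat (xs ! 1) (\<lambda>_ _. xs ! 2) (xs ! 0))"
    by (intro total_recursive_intros) simp_all
  note total_recursive_compose3[OF this, total_recursive_intros]
  \<comment> \<open>The iteration returns \<open>c\<close> after zero rounds and \<open>d\<close>
    after any positive number; with truncated subtraction the count is zero exactly when
    \<open>a = b\<close>.\<close>
  have eq: "(if a = b then c else d) = rec_nat c (\<lambda>_ _. d) ((a - b) + (b - a))"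
    for a b c d :: nat
    by (cases "(a - b) + (b - a)") auto
  show ?thesis unfolding eq by (intro total_recursive_intros assms)
qed

lemma total_recursive_if_le [total_recursive_intros]:
  assumes "total_recursive k p" "total_recursive k q" "total_recursive k f" "total_recursive k g"
  shows "total_recursive k (\<lambda>xs. if p xs \<le> q xs then f xs else g xs)"
proof -
  have eq: "(if a \<le> b then c else d) = (if a - b = 0 then c else d)" for a b c d :: nat by simp
  show ?thesis unfolding eq by (intro total_recursive_intros assms)
qed

lemma total_recursive_triangle [total_recursive_intros]:
  assumes "total_recursive k f" shows "total_recursive k (\<lambda>xs. triangle (f xs))"
proof -
  have eq: "triangle n = rec_nat 0 (\<lambda>i y. y + Suc i) n" for n by (induction n) auto
  show ?thesis unfolding eq by (intro total_recursive_intros assms) simp_all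
qed

lemma total_recursive_prod_encode [total_recursive_intros]:
  assumes "total_recursive k f" "total_recursive k g"
  shows "total_recursive k (\<lambda>xs. prod_encode (f xs, g xs))"
  unfolding prod_encode_def prod.case by (intro total_recursive_intros assms)

text \<open>This is the largest \<open>s\<close> with \<open>triangle s \<le> n\<close>; it grows by
  at most one from \<open>n\<close> to \<open>Suc n\<close>. It inverts pairing because
  \<open>prod_encode (a, b) = triangle (a + b) + a\<close> lies below
  \<open>triangle (Suc (a + b))\<close>.\<close>

definition triangle_root :: "nat \<Rightarrow> nat" where
  "triangle_root n = rec_nat 0 (\<lambda>i s. if triangle (Suc s) \<le> Suc i then Suc s else s) n"

lemma triangle_root_bounds:
  "triangle (triangle_root n) \<le> n \<and> n < triangle (Suc (triangle_root n))"
  by (induction n) (auto simp: triangle_root_def)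

lemma triangle_mono: "m \<le> n \<Longrightarrow> triangle m \<le> triangle n"
  by (induction n) (auto simp: le_Suc_eq)

lemma triangle_root_prod_encode: "triangle_root (prod_encode (a, b)) = a + b"
proof -
  let ?n = "prod_encode (a, b)"
  have n: "triangle (a + b) \<le> ?n" "?n < triangle (Suc (a + b))"
    by (auto simp: prod_encode_def)
  note root = triangle_root_bounds[of ?n]
  have "\<not> triangle_root ?n < a + b" "\<not> a + b < triangle_root ?n"
    using n root triangle_mono[of "Suc (triangle_root ?n)" "a + b"]
      triangle_mono[of "Suc (a + b)" "triangle_root ?n"] by auto
  then show ?thesis by linarith
qed

lemma prod_decode_conv_triangle_root:
  "fst (prod_decode n) = n - triangle (triangle_root n)"
  "snd (prod_decode n) = triangle_root n - (n - triangle (triangle_root n))"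
proof -
  obtain a b where "n = prod_encode (a, b)" by (metis prod_decode_inverse surj_pair)
  then show "fst (prod_decode n) = n - triangle (triangle_root n)"
    "snd (prod_decode n) = triangle_root n - (n - triangle (triangle_root n))"
    by (simp_all add: triangle_root_prod_encode) (simp_all add: prod_encode_def)
qed

lemma total_recursive_triangle_root [total_recursive_intros]:
  assumes "total_recursive k f" shows "total_recursive k (\<lambda>xs. triangle_root (f xs))"
  unfolding triangle_root_def by (intro total_recursive_intros assms) simp_all

lemma total_recursive_prod_decode [total_recursive_intros]:
  assumes "total_recursive k f"
  shows "total_recursive k (\<lambda>xs. fst (prod_decode (f xs)))"
    and "total_recursive k (\<lambda>xs. snd (prod_decode (f xs)))"
  unfolding prod_decode_conv_triangle_root by (intro total_recursive_intros assms)+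

lemma total_recursive_odd [total_recursive_intros]:
  assumes "total_recursive k f" shows "total_recursive k (\<lambda>xs. of_bool (odd (f xs)))"
proof -
  have "rec_nat (0::nat) (\<lambda>_ y. 1 - y) n = of_bool (odd n)" for n :: nat
    by (induction n) auto
  note eq = this[symmetric]
  show ?thesis unfolding eq by (intro total_recursive_intros assms) simp_all
qed

text \<open>With \<open>odd\<close> this reads single bits, and hence decides membership in
  \<open>set_decode\<close>.\<close>

lemma total_recursive_div_power_2 [total_recursive_intros]:
  assumes "total_recursive k f" "total_recursive k g"
  shows "total_recursive k (\<lambda>xs. f xs div 2 ^ g xs)"
proof -
  \<comment> \<open>The half grows exactly on passing from an odd \<open>i\<close> to
    \<open>Suc i\<close>.\<close>
  have half: "n div 2 = rec_nat 0 (\<lambda>i y. y + of_bool (odd i)) n" for n :: nat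
    by (induction n) (auto elim!: oddE evenE)
  have power: "m div 2 ^ n = rec_nat m (\<lambda>_ y. y div 2) n" for m n :: nat
    by (induction n) (simp_all add: div_mult2_eq power_Suc2 del: power_Suc)
  have "total_recursive j h \<Longrightarrow> total_recursive j (\<lambda>xs. h xs div 2)" for j h
    unfolding half by (intro total_recursive_intros) simp_all
  note this[total_recursive_intros]
  show ?thesis unfolding power by (intro total_recursive_intros assms) simp_all
qed

lemma total_recursive_power_2 [total_recursive_intros]:
  assumes "total_recursive k f" shows "total_recursive k (\<lambda>xs. 2 ^ f xs)"
proof -
  have eq: "2 ^ n = rec_nat (1::nat) (\<lambda>_ y. y + y) n" for n :: nat by (induction n) auto
  show ?thesis unfolding eq by (intro total_recursive_intros assms) simp_all
qed

subsection \<open>Course-of-values recursion\<close>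

text \<open>The history is the code of the list of the values below \<open>n\<close>, latest first, so that \<open>lookup\<close> drops
  \<open>n - Suc k\<close> entries to reach the value at \<open>k\<close>.\<close>

primrec history :: "(nat \<Rightarrow> nat \<Rightarrow> nat \<Rightarrow> nat) \<Rightarrow> nat \<Rightarrow> nat \<Rightarrow> nat" where
  "history st x 0 = 0"
| "history st x (Suc n) = Suc (prod_encode (st x n (history st x n), history st x n))"

definition cov_rec :: "(nat \<Rightarrow> nat \<Rightarrow> nat \<Rightarrow> nat) \<Rightarrow> nat \<Rightarrow> nat \<Rightarrow> nat" where
  "cov_rec st x n = st x n (history st x n)"

definition lookup :: "nat \<Rightarrow> nat \<Rightarrow> nat \<Rightarrow> nat" where
  "lookup h n k =
     fst (prod_decode (rec_nat h (\<lambda>_ y. snd (prod_decode (y - 1))) (n - Suc k) - 1))"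

text \<open>Each pass of the iteration removes the latest entry, so \<open>n - Suc k\<close> passes
  leave \<open>history st x (Suc k)\<close>, whose head is the value at \<open>k\<close>.\<close>

lemma lookup_history:
  assumes "k < n"
  shows "lookup (history st x n) n k = cov_rec st x k"
proof -
  have tails: "rec_nat (history st x (m + d)) (\<lambda>_ y. snd (prod_decode (y - 1))) d = history st x m"
    for m d
  proof -
    have "rec_nat (history st x (m + d)) (\<lambda>_ y. snd (prod_decode (y - 1))) j
        = history st x (m + (d - j))" if "j \<le> d" for j
      using that
    proof (induction j)
      case (Suc j)
      then have "m + (d - j) = Suc (m + (d - Suc j))" by simp
      with Suc show ?case by simp
    qed simp
    then show ?thesis by simp
  qed
  have "n = Suc k + (n - Suc k)" using assms by simp
  then have "rec_nat (history st x n) (\<lambda>_ y. snd (prod_decode (y - 1))) (n - Suc k)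
      = history st x (Suc k)" using tails by metis
  then show ?thesis by (simp add: lookup_def cov_rec_def)
qed

lemma total_recursive_lookup [total_recursive_intros]:
  assumes "total_recursive k f" "total_recursive k g" "total_recursive k h"
  shows "total_recursive k (\<lambda>xs. lookup (f xs) (g xs) (h xs))"
  unfolding lookup_def by (intro total_recursive_intros assms) simp_all

lemma total_recursive_cov_rec:
  assumes "total_recursive 3 (\<lambda>xs. st (xs ! 0) (xs ! 1) (xs ! 2))"
    and "total_recursive k f" "total_recursive k g"
  shows "total_recursive k (\<lambda>xs. cov_rec st (f xs) (g xs))"
proof -
  note st [total_recursive_intros] = total_recursive_compose3[OF assms(1)]
  have "history st x n = rec_nat 0 (\<lambda>i h. Suc (prod_encode (st x i h, h))) n" for x n
    by (induction n) auto
  \<comment> \<open>The parameter \<open>x\<close> becomes a projection here, so that it stays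
    tractable inside the step function.\<close>
  moreover have "total_recursive 2
      (\<lambda>xs. rec_nat 0 (\<lambda>i h. Suc (prod_encode (st (xs ! 0) i h, h))) (xs ! 1))"
    by (intro total_recursive_intros) simp_all
  ultimately have "total_recursive 2 (\<lambda>xs. history st (xs ! 0) (xs ! 1))" by simp
  note total_recursive_compose2[OF this, total_recursive_intros]
  show ?thesis unfolding cov_rec_def by (intro total_recursive_intros assms)
qed

section \<open>Membership in a coded list\<close>

definition list_member_step :: "nat \<Rightarrow> nat \<Rightarrow> nat \<Rightarrow> nat" where
  "list_member_step x l h =
     (if l = 0 then 0 else if fst (prod_decode (l - 1)) = x then 1
      else lookup h l (snd (prod_decode (l - 1))))"

lemma total_recursive_list_member [total_recursive_intros]:
  assumes "total_recursive k f" "total_recursive k g"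
  shows "total_recursive k (\<lambda>xs. cov_rec list_member_step (f xs) (g xs))"
  by (intro total_recursive_cov_rec assms; unfold list_member_step_def)
    (intro total_recursive_intros; simp)

lemma cov_rec_list_member: "cov_rec list_member_step x (list_encode xs) = of_bool (x \<in> set xs)"
proof (induction xs)
  case (Cons y ys)
  have "list_encode ys < list_encode (y # ys)" using le_prod_encode_2 by (simp add: less_Suc_eq_le)
  note lookup = lookup_history[OF this]
  show ?case
    unfolding cov_rec_def[of list_member_step x "list_encode (y # ys)"]
    by (subst list_member_step_def) (use Cons lookup in simp)
qed (simp add: cov_rec_def list_member_step_def)

text \<open>The codes of finite lists are built downwards from \<open>n - 1\<close>, since primitive recursion puts the
  last index in front.\<close>

lemma rec_nat_list_encode:
  "rec_nat 0 (\<lambda>i y. if p i = 0 then y else Suc (prod_encode (g i, y))) n =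
   list_encode (map g (filter (\<lambda>i. p i \<noteq> (0::nat)) (rev [0..<n])))"
  by (induction n) auto

section \<open>Typing at a single attribute\<close>

text \<open>\<open>Cup\<close> and \<open>Minus\<close> consult only the left operand, since
  agreement of the two operands is demanded by \<open>attr_wt\<close>; the formula describes a type
  only when the expression is well-typed.\<close>

fun attr_out :: "attr \<Rightarrow> expr \<Rightarrow> bform" where
  "attr_out X (Relvar r) = VarF r"
| "attr_out X (Cup e1 e2) = attr_out X e1"
| "attr_out X (Minus e1 e2) = attr_out X e1"
| "attr_out X (NatJoin e1 e2) = OrF (attr_out X e1) (attr_out X e2)"
| "attr_out X (Product e1 e2) = OrF (attr_out X e1) (attr_out X e2)"
| "attr_out X (Select \<theta> As e) = attr_out X e"
| "attr_out X (Project As e) = (if X \<in> set As then TrueF else FalseF)"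
| "attr_out X (Rename A B e) = (if X = B then TrueF else if X = A then FalseF else attr_out X e)"
| "attr_out X (ProjectAway A e) = (if X = A then FalseF else attr_out X e)"

abbreviation IffF :: "bform \<Rightarrow> bform \<Rightarrow> bform" where
  "IffF p q \<equiv> OrF (AndF p q) (AndF (NotF p) (NotF q))"

text \<open>Typing premises split by attribute: equality of types becomes an equivalence,
  disjointness a negated conjunction, and a membership constrains the named attribute alone. For
  \<open>A = B\<close>, \<open>Rename\<close> demands both \<open>attr_out A e\<close> and its
  negation, which reflects that the rule cannot apply.\<close>

fun attr_wt :: "attr \<Rightarrow> expr \<Rightarrow> bform" where
  "attr_wt X (Relvar r) = TrueF"
| "attr_wt X (Cup e1 e2) =
     AndF (AndF (attr_wt X e1) (attr_wt X e2)) (IffF (attr_out X e1) (attr_out X e2))"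
| "attr_wt X (Minus e1 e2) =
     AndF (AndF (attr_wt X e1) (attr_wt X e2)) (IffF (attr_out X e1) (attr_out X e2))"
| "attr_wt X (NatJoin e1 e2) = AndF (attr_wt X e1) (attr_wt X e2)"
| "attr_wt X (Product e1 e2) =
     AndF (AndF (attr_wt X e1) (attr_wt X e2)) (NotF (AndF (attr_out X e1) (attr_out X e2)))"
| "attr_wt X (Select \<theta> As e) =
     (if X \<in> set As then AndF (attr_wt X e) (attr_out X e) else attr_wt X e)"
| "attr_wt X (Project As e) =
     (if X \<in> set As then AndF (attr_wt X e) (attr_out X e) else attr_wt X e)"
| "attr_wt X (Rename A B e) =
     AndF (AndF (attr_wt X e) (if X = A then attr_out X e else TrueF))
       (if X = B then NotF (attr_out X e) else TrueF)"
| "attr_wt X (ProjectAway A e) =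
     (if X = A then AndF (attr_wt X e) (attr_out X e) else attr_wt X e)"

inductive_simps has_type_simps:
  "T \<turnstile> Relvar r : \<tau>" "T \<turnstile> Cup e1 e2 : \<tau>" "T \<turnstile> Minus e1 e2 : \<tau>" "T \<turnstile> NatJoin e1 e2 : \<tau>"
  "T \<turnstile> Product e1 e2 : \<tau>" "T \<turnstile> Select \<theta> As e : \<tau>" "T \<turnstile> Project As e : \<tau>"
  "T \<turnstile> Rename A B e : \<tau>" "T \<turnstile> ProjectAway A e : \<tau>"

text \<open>A type is unique if it exists, so by induction each rule premise compares sets already
  described by \<open>attr_out\<close>; reading set equality and disjointness pointwise gives one
  condition per attribute.\<close>

lemma has_type_iff:
  "T \<turnstile> e : \<tau> \<longleftrightarrow>
     (\<forall>X. satisfies {r. X \<in> T r} (attr_wt X e)) \<and>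
     \<tau> = {X. satisfies {r. X \<in> T r} (attr_out X e)}"
proof (induction e arbitrary: \<tau>)
  case (Rename A B e)
  then show ?case by (simp add: has_type_simps) (auto split: if_splits)
next
  case (ProjectAway A e)
  then show ?case by (simp add: has_type_simps) (auto split: if_splits)
next
  case (Select \<theta> As e)
  then show ?case by (simp add: has_type_simps) (auto split: if_splits)
next
  case (Project As e)
  then show ?case by (simp add: has_type_simps) (auto split: if_splits)
next
  case (Cup e1 e2)
  then show ?case by (simp add: has_type_simps) blast
next
  case (Minus e1 e2)
  then show ?case by (simp add: has_type_simps) blast
next
  case (NatJoin e1 e2)
  then show ?case by (simp add: has_type_simps) blast
next
  case (Product e1 e2)
  then show ?case by (simp add: has_type_simps) blast
qed (auto simp: has_type_simps)

section \<open>Dependence on relation variables and on fresh attributes\<close>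

lemma bform_vars_attr_out: "bform_vars (attr_out X e) \<subseteq> expr_relvars e"
  by (induction e) auto

lemma bform_vars_attr_wt: "bform_vars (attr_wt X e) \<subseteq> expr_relvars e"
  by (induction e) (use bform_vars_attr_out[of X] in auto)

text \<open>\<open>X\<close> enters the definition only through comparisons with names occurring in
  \<open>e\<close>.\<close>

lemma attr_out_fresh_cong:
  "X \<notin> expr_attrs e \<Longrightarrow> Y \<notin> expr_attrs e \<Longrightarrow> attr_out X e = attr_out Y e"
  by (induction e) auto

lemma attr_wt_fresh_cong:
  "X \<notin> expr_attrs e \<Longrightarrow> Y \<notin> expr_attrs e \<Longrightarrow> attr_wt X e = attr_wt Y e"
  by (induction e) (auto simp: attr_out_fresh_cong)

text \<open>For fresh \<open>X\<close> the formula is built from variables and \<open>FalseF\<close>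
  by \<open>OrF\<close> alone.\<close>

lemma not_satisfies_empty_attr_out: "X \<notin> expr_attrs e \<Longrightarrow> \<not> satisfies {} (attr_out X e)"
  by (induction e) auto

text \<open>Both sides of every equivalence and disjointness condition are false here. Hence
  attributes that occur in no relation type need no type variable.\<close>

lemma satisfies_empty_attr_wt: "X \<notin> expr_attrs e \<Longrightarrow> satisfies {} (attr_wt X e)"
  by (induction e) (auto simp: not_satisfies_empty_attr_out)

lemma satisfies_cong:
  "M \<inter> bform_vars p = N \<inter> bform_vars p \<Longrightarrow> satisfies M p \<longleftrightarrow> satisfies N p"
proof (induction p)
  case (AndF p q)
  then have "M \<inter> bform_vars p = N \<inter> bform_vars p" "M \<inter> bform_vars q = N \<inter> bform_vars q" by auto
  with AndF.IH show ?case by simp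
next
  case (OrF p q)
  then have "M \<inter> bform_vars p = N \<inter> bform_vars p" "M \<inter> bform_vars q = N \<inter> bform_vars q" by auto
  with OrF.IH show ?case by simp
qed auto

text \<open>Type assignments are total functions and a bitmask may contain numbers foreign to
  \<open>e\<close>; only the part inside \<open>expr_relvars e\<close> is relevant.\<close>

lemma satisfies_cong_relvars:
  assumes "M \<inter> expr_relvars e = N \<inter> expr_relvars e"
  shows "satisfies M (attr_wt X e) \<longleftrightarrow> satisfies N (attr_wt X e)"
    and "satisfies M (attr_out X e) \<longleftrightarrow> satisfies N (attr_out X e)"
  using assms bform_vars_attr_wt[of X e] bform_vars_attr_out[of X e]
  by (intro satisfies_cong; blast)+

section \<open>The principal type formula\<close>

lemma finite_expr_relvars: "finite (expr_relvars e)"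
  by (induction e) auto

lemma member_le_list_encode: "x \<in> set xs \<Longrightarrow> x < list_encode xs"
proof (induction xs)
  case (Cons y ys)
  then show ?case
    using le_prod_encode_1[of y "list_encode ys"] le_prod_encode_2[of "list_encode ys" y]
    by (auto simp: less_Suc_eq_le intro: order_trans less_imp_le)
qed simp

lemma prod_encode_le_trans:
  "x \<le> a \<Longrightarrow> x \<le> prod_encode (a, b)" "x \<le> b \<Longrightarrow> x \<le> prod_encode (a, b)"
  using le_prod_encode_1 le_prod_encode_2 order_trans by blast+

lemma expr_relvars_le_encode: "r \<in> expr_relvars e \<Longrightarrow> r \<le> expr_encode e"
  by (induction e) (auto intro: prod_encode_le_trans)

text \<open>So \<open>{..expr_encode e}\<close> contains all names of \<open>e\<close>, is
  computable without traversing \<open>e\<close>, and leaves \<open>Suc (expr_encode e)\<close>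
  fresh.\<close>

lemma expr_attrs_le_encode: "A \<in> expr_attrs e \<Longrightarrow> A \<le> expr_encode e"
  by (induction e)
    (auto intro: prod_encode_le_trans dest!: member_le_list_encode intro: less_imp_le)

text \<open>A type variable is the bitmask of a set \<open>M\<close> of relation variables and stands for the
  non-special attributes occurring in the types of exactly the relation variables in \<open>M\<close>.\<close>

definition principal_tvars :: "expr \<Rightarrow> tvar set" where
  "principal_tvars e =
     {m. m < 2 ^ Suc (expr_encode e) \<and>
         satisfies (set_decode m) (attr_wt (Suc (expr_encode e)) e)}"

text \<open>\<open>Suc (expr_encode e)\<close> is a sample fresh attribute: by the congruence lemmas
  its formulas are those of every non-special attribute.\<close>

definition principal_formula :: "expr \<Rightarrow> type_formula" where
  "principal_formula e =
     \<lparr>context_of =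
        \<lparr>Relvars = expr_relvars e,
         Typevars = principal_tvars e,
         decl = (\<lambda>r. {m \<in> principal_tvars e. r \<in> set_decode m}),
         Specattrs = {..expr_encode e},
         constraint = (\<lambda>A. attr_wt A e)\<rparr>,
      expr_of = e,
      Outvars = {m \<in> principal_tvars e.
        satisfies (set_decode m) (attr_out (Suc (expr_encode e)) e)},
      outatt = (\<lambda>A. attr_out A e)\<rparr>"

lemma is_type_formula_principal_formula: "is_type_formula (principal_formula e)"
  by (auto simp: is_type_formula_def is_type_context_def principal_formula_def finite_expr_relvars
      principal_tvars_def expr_attrs_le_encode dest: bform_vars_attr_wt[THEN subsetD]
      bform_vars_attr_out[THEN subsetD])

lemma set_encode_less_power:
  assumes "S \<subseteq> {..n}" shows "set_encode S < 2 ^ Suc n"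
proof -
  have "set_encode S \<le> (\<Sum>i\<in>{..n}. 2 ^ i)"
    unfolding set_encode_def using assms by (intro sum_mono2) auto
  also have "\<dots> < 2 ^ Suc n" by (induction n) auto
  finally show ?thesis .
qed

text \<open>Every non-special attribute occurring in \<open>T\<close> is put into the type variable
  coding the set of relation variables that have it, which makes distinct type variables
  disjoint.\<close>

lemma principal_instantiation_exists:
  assumes T: "type_assignment_on (expr_relvars e) T" and ty: "T \<turnstile> e : \<tau>"
  shows "\<exists>I. is_instantiation (context_of (principal_formula e)) I \<and>
    (\<forall>r\<in>Relvars (context_of (principal_formula e)).
       inst_image (context_of (principal_formula e)) I r = T r) \<and>
    \<tau> = output_type (principal_formula e) I"
proof -
  let ?n = "expr_encode e" and ?R = "expr_relvars e"
  define S where "S X = {r \<in> ?R. X \<in> T r}" for X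
  have wt: "satisfies (S X) (attr_wt X e)"
    and out: "X \<in> \<tau> \<longleftrightarrow> satisfies (S X) (attr_out X e)" for X
    using ty satisfies_cong_relvars[of "S X" e "{r. X \<in> T r}"]
    by (auto simp: has_type_iff S_def)
  have fin_S: "finite (S X)" for X using finite_expr_relvars by (simp add: S_def)
  have S_le: "S X \<subseteq> {..?n}" for X using expr_relvars_le_encode by (auto simp: S_def)
  have fresh: "X \<notin> expr_attrs e" if "X > ?n" for X using that expr_attrs_le_encode by force
  note fresh_eqs = attr_wt_fresh_cong[OF fresh fresh] attr_out_fresh_cong[OF fresh fresh]
  \<comment> \<open>Restricting to attributes occurring in \<open>T\<close> keeps the types finite:
    mask \<open>0\<close> would otherwise receive the infinitely many attributes absent from all
    types.\<close>
  define I where "I = \<lparr>on_tvar = (\<lambda>m. {X \<in> \<Union>(T ` ?R). X > ?n \<and> set_encode (S X) = m}),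
    on_attr = S\<rparr>"
  have tv: "X \<le> ?n \<or> set_encode (S X) \<in> principal_tvars e" for X
  proof (cases "X \<le> ?n")
    case False
    then have "X > ?n" by simp
    then show ?thesis
      using wt[of X] set_encode_less_power[OF S_le] fresh_eqs(1)[of X "Suc ?n"]
      by (simp add: principal_tvars_def set_encode_inverse fin_S)
  qed simp
  show ?thesis
  proof (intro exI[of _ I] conjI)
    show "is_instantiation (context_of (principal_formula e)) I"
      using T finite_expr_relvars wt
      by (auto simp: is_instantiation_def principal_formula_def I_def type_assignment_on_def S_def
          intro: rev_finite_subset[of "\<Union>(T ` ?R)"])
    show "\<forall>r\<in>Relvars (context_of (principal_formula e)).
       inst_image (context_of (principal_formula e)) I r = T r"
      using tv fin_S
      by (auto simp: inst_image_def principal_formula_def I_def set_encode_inverse)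
        (use tv in \<open>auto simp: S_def\<close>)
    \<comment> \<open>The restriction loses no output attribute, since a fresh attribute in the
      output must occur in some \<open>T r\<close>.\<close>
    have nonempty: "X \<in> \<Union>(T ` ?R)" if "X > ?n" "satisfies (S X) (attr_out X e)" for X
    proof -
      have "S X \<noteq> {}" using that not_satisfies_empty_attr_out[OF fresh, of X] by auto
      then show ?thesis by (auto simp: S_def)
    qed
    show "\<tau> = output_type (principal_formula e) I"
    proof (rule set_eqI)
      fix X show "X \<in> \<tau> \<longleftrightarrow> X \<in> output_type (principal_formula e) I"
      proof (cases "X \<le> ?n")
        case True
        then show ?thesis by (auto simp: output_type_def principal_formula_def I_def out)
      next
        case False
        then show ?thesis
          using nonempty[of X] tv[of X] fresh_eqs(2)[of X "Suc ?n"] fin_S[of X]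
          by (auto simp: output_type_def principal_formula_def I_def out set_encode_inverse)
      qed
    qed
  qed
qed

text \<open>By \<open>has_type_iff\<close> one attribute at a time can be treated; it is special, or
  in the type of exactly one type variable, or in no such type at all.\<close>

lemma principal_instantiation_has_type:
  assumes I: "is_instantiation (context_of (principal_formula e)) I"
    and T: "\<And>r. r \<in> expr_relvars e \<Longrightarrow> inst_image (context_of (principal_formula e)) I r = T r"
  shows "T \<turnstile> e : output_type (principal_formula e) I"
proof -
  let ?n = "expr_encode e" and ?R = "expr_relvars e"
  let ?S = "\<lambda>X. {r. X \<in> T r}"
  have fresh: "X \<notin> expr_attrs e" if "X > ?n" for X using that expr_attrs_le_encode by force
  note fresh_eqs = attr_wt_fresh_cong[OF fresh fresh] attr_out_fresh_cong[OF fresh fresh]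
  have gt: "X > ?n" if "m \<in> principal_tvars e" "X \<in> on_tvar I m" for m X
    using I that by (force simp: is_instantiation_def principal_formula_def)
  have unique: "m = m'" if "m \<in> principal_tvars e" "X \<in> on_tvar I m"
    "m' \<in> principal_tvars e" "X \<in> on_tvar I m'" for m m' X
    using I that by (auto simp: is_instantiation_def principal_formula_def)
  have mem_T: "X \<in> T r \<longleftrightarrow>
      (\<exists>m\<in>principal_tvars e. r \<in> set_decode m \<and> X \<in> on_tvar I m) \<or> (X \<le> ?n \<and> r \<in> on_attr I X)"
    if "r \<in> ?R" for r X
    unfolding T[OF that, symmetric] by (auto simp: inst_image_def principal_formula_def)
  have "satisfies (?S X) (attr_wt X e) \<and>
      (satisfies (?S X) (attr_out X e) \<longleftrightarrow> X \<in> output_type (principal_formula e) I)" for X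
  proof -
    consider "X \<le> ?n" | m where "X > ?n" "m \<in> principal_tvars e" "X \<in> on_tvar I m"
      | "X > ?n" "\<forall>m\<in>principal_tvars e. X \<notin> on_tvar I m"
      by (meson not_le)
    then show ?thesis
    proof cases
      case 1
      then have "?S X \<inter> ?R = on_attr I X \<inter> ?R" using mem_T gt by fastforce
      note cong = satisfies_cong_relvars[OF this, of X]
      show ?thesis unfolding cong using I 1 gt
        by (force simp: is_instantiation_def output_type_def principal_formula_def)
    next
      case (2 m)
      have "r \<in> ?R \<Longrightarrow> X \<in> T r \<longleftrightarrow> r \<in> set_decode m" for r
        using mem_T[of r X] 2 unique[OF 2(2,3)] by (metis not_le)
      \<comment> \<open>Equality holds only within \<open>?R\<close>: the mask \<open>m\<close> may
        have bits that are no relation variables of \<open>e\<close>.\<close>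
      then have "?S X \<inter> ?R = set_decode m \<inter> ?R" by blast
      note cong = satisfies_cong_relvars[OF this, of X]
      have eqs: "attr_wt X e = attr_wt (Suc ?n) e" "attr_out X e = attr_out (Suc ?n) e"
        using fresh_eqs[of X "Suc ?n"] 2(1) by simp_all
      have "X \<in> output_type (principal_formula e) I \<longleftrightarrow>
          (\<exists>m'\<in>principal_tvars e. X \<in> on_tvar I m' \<and> satisfies (set_decode m') (attr_out (Suc ?n) e))"
        using 2(1) by (auto simp: output_type_def principal_formula_def)
      also have "\<dots> \<longleftrightarrow> satisfies (set_decode m) (attr_out (Suc ?n) e)"
        using 2(2,3) unique[OF 2(2,3)] by blast
      finally have "X \<in> output_type (principal_formula e) I \<longleftrightarrow>
          satisfies (set_decode m) (attr_out (Suc ?n) e)" .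
      then show ?thesis unfolding cong unfolding eqs using 2(2) by (simp add: principal_tvars_def)
    next
      case 3
      then have "r \<in> ?R \<Longrightarrow> X \<notin> T r" for r
        using mem_T[of r X] by auto
      then have "?S X \<inter> ?R = {} \<inter> ?R" by blast
      note cong = satisfies_cong_relvars[OF this, of X]
      show ?thesis unfolding cong
        using 3 satisfies_empty_attr_wt[OF fresh, of X] not_satisfies_empty_attr_out[OF fresh, of X]
        by (auto simp: output_type_def principal_formula_def)
    qed
  qed
  then show ?thesis unfolding has_type_iff by blast
qed

lemma principal_for_principal_formula: "principal_for (principal_formula e) e"
proof -
  have "expr_of (principal_formula e) = e" "Relvars (context_of (principal_formula e)) = expr_relvars e"
    by (simp_all add: principal_formula_def)
  then show ?thesis
    unfolding principal_for_def
    using is_type_formula_principal_formula principal_instantiation_exists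
      principal_instantiation_has_type[of e] by metis
qed

section \<open>Computing the principal type formula\<close>

text \<open>Lookups must go to strictly smaller numbers. Tag \<open>0\<close> is given to
  \<open>Relvar\<close> and \<open>FalseF\<close>, which have no subterms, so positive tags are
  enough.\<close>

lemma less_prod_encode:
  assumes "0 < t" shows "r < prod_encode (t, r)"
proof -
  \<comment> \<open>\<open>triangle r\<close> is \<open>prod_encode (0, r)\<close>.\<close>
  have "r \<le> triangle r" using le_prod_encode_2[of r 0] by (simp add: prod_encode_def)
  also have "\<dots> \<le> triangle (t + r)" by (rule triangle_mono) simp
  also have "\<dots> < prod_encode (t, r)" using assms by (simp add: prod_encode_def)
  finally show ?thesis .
qed

lemma less_prod_encode_nested:
  assumes "0 < t"
  shows "a < prod_encode (t, prod_encode (a, b))" "b < prod_encode (t, prod_encode (a, b))"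
  using less_prod_encode[OF assms, of "prod_encode (a, b)"] le_prod_encode_1[of a b]
    le_prod_encode_2[of b a] by simp_all

lemmas lookup_prod_encode =
  lookup_history[OF less_prod_encode] lookup_history[OF less_prod_encode_nested(1)]
  lookup_history[OF less_prod_encode_nested(2)]

section \<open>Evaluating formulas and finding relation variables on codes\<close>

abbreviation (input) "tag n \<equiv> fst (prod_decode n)"
abbreviation (input) "arg n \<equiv> snd (prod_decode n)"
abbreviation (input) "arg1 n \<equiv> fst (prod_decode (arg n))"
abbreviation (input) "arg2 n \<equiv> snd (prod_decode (arg n))"

text \<open>Truth values are \<open>0\<close> and \<open>1\<close>; the last branch is
  \<open>OrF\<close>, and also gives some value to numbers that are no codes.\<close>

definition satisfies_step :: "nat \<Rightarrow> nat \<Rightarrow> nat \<Rightarrow> nat" where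
  "satisfies_step m n h =
     (if tag n = 0 then 0
      else if tag n = 1 then 1
      else if tag n = 2 then of_bool (odd (m div 2 ^ arg n))
      else if tag n = 3 then 1 - lookup h n (arg n)
      else if tag n = 4 then (if lookup h n (arg1 n) = 0 then 0 else lookup h n (arg2 n))
      else if lookup h n (arg1 n) = 0 then lookup h n (arg2 n) else 1)"

lemma total_recursive_satisfies [total_recursive_intros]:
  assumes "total_recursive k f" "total_recursive k g"
  shows "total_recursive k (\<lambda>xs. cov_rec satisfies_step (f xs) (g xs))"
  by (intro total_recursive_cov_rec assms; unfold satisfies_step_def)
    (intro total_recursive_intros; simp)

lemma cov_rec_satisfies:
  "cov_rec satisfies_step m (bform_encode p) = of_bool (satisfies (set_decode m) p)"
proof (induction p)
  case (VarF r)
  show ?case by (simp add: cov_rec_def satisfies_step_def set_decode_def)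
qed (simp add: cov_rec_def; subst satisfies_step_def; simp add: lookup_prod_encode)+

text \<open>Counts occurrences, so that addition serves as disjunction. Tags \<open>1\<close> to
  \<open>4\<close> have two subexpressions; the later ones keep theirs in the second
  component.\<close>

definition occurs_step :: "nat \<Rightarrow> nat \<Rightarrow> nat \<Rightarrow> nat" where
  "occurs_step r n h =
     (if tag n = 0 then (if arg n = r then 1 else 0)
      else if tag n \<le> 4 then lookup h n (arg1 n) + lookup h n (arg2 n)
      else lookup h n (arg2 n))"

lemma total_recursive_occurs [total_recursive_intros]:
  assumes "total_recursive k f" "total_recursive k g"
  shows "total_recursive k (\<lambda>xs. cov_rec occurs_step (f xs) (g xs))"
  by (intro total_recursive_cov_rec assms; unfold occurs_step_def)
    (intro total_recursive_intros; simp)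

lemma cov_rec_occurs: "cov_rec occurs_step r (expr_encode e) = 0 \<longleftrightarrow> r \<notin> expr_relvars e"
  by (induction e; simp only: expr_encode.simps; subst cov_rec_def; subst occurs_step_def;
      simp add: lookup_prod_encode)

section \<open>The attribute formulas on codes\<close>

abbreviation (input) "var_code r \<equiv> prod_encode (2, r)"
abbreviation (input) "not_code p \<equiv> prod_encode (3, p)"
abbreviation (input) "and_code p q \<equiv> prod_encode (4, prod_encode (p, q))"
abbreviation (input) "or_code p q \<equiv> prod_encode (5, prod_encode (p, q))"
abbreviation (input) "iff_code p q \<equiv> or_code (and_code p q) (and_code (not_code p) (not_code q))"

abbreviation (input) "out1 n h \<equiv> fst (prod_decode (lookup h n (arg1 n)))"
abbreviation (input) "wt1 n h \<equiv> snd (prod_decode (lookup h n (arg1 n)))"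
abbreviation (input) "out2 n h \<equiv> fst (prod_decode (lookup h n (arg2 n)))"
abbreviation (input) "wt2 n h \<equiv> snd (prod_decode (lookup h n (arg2 n)))"

text \<open>Both formulas are computed together as a pair, since \<open>attr_wt\<close> needs
  \<open>attr_out\<close> of the subexpressions. The branches follow the tags of
  \<open>expr_encode\<close>, \<open>Cup\<close> and \<open>Minus\<close> sharing one.\<close>

definition attr_step :: "nat \<Rightarrow> nat \<Rightarrow> nat \<Rightarrow> nat" where
  "attr_step X n h =
     (if tag n = 0 then prod_encode (var_code (arg n), bform_encode TrueF)
      else if tag n \<le> 2 then
        prod_encode (out1 n h, and_code (and_code (wt1 n h) (wt2 n h)) (iff_code (out1 n h) (out2 n h)))
      else if tag n = 3 then
        prod_encode (or_code (out1 n h) (out2 n h), and_code (wt1 n h) (wt2 n h))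
      else if tag n = 4 then
        prod_encode (or_code (out1 n h) (out2 n h),
          and_code (and_code (wt1 n h) (wt2 n h)) (not_code (and_code (out1 n h) (out2 n h))))
      else if tag n = 5 then
        prod_encode (out2 n h,
          if cov_rec list_member_step X (snd (prod_decode (arg1 n))) = 1
          then and_code (wt2 n h) (out2 n h) else wt2 n h)
      else if tag n = 6 then
        prod_encode
         (if cov_rec list_member_step X (arg1 n) = 1
          then bform_encode TrueF else bform_encode FalseF,
          if cov_rec list_member_step X (arg1 n) = 1
          then and_code (wt2 n h) (out2 n h) else wt2 n h)
      else if tag n = 7 then
        prod_encode
         (if X = snd (prod_decode (arg1 n)) then bform_encode TrueF
          else if X = fst (prod_decode (arg1 n)) then bform_encode FalseF else out2 n h,
          and_code
            (and_code (wt2 n h)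
              (if X = fst (prod_decode (arg1 n)) then out2 n h else bform_encode TrueF))
            (if X = snd (prod_decode (arg1 n)) then not_code (out2 n h) else bform_encode TrueF))
      else
        prod_encode (if X = arg1 n then bform_encode FalseF else out2 n h,
          if X = arg1 n then and_code (wt2 n h) (out2 n h) else wt2 n h))"

lemma total_recursive_attr [total_recursive_intros]:
  assumes "total_recursive k f" "total_recursive k g"
  shows "total_recursive k (\<lambda>xs. cov_rec attr_step (f xs) (g xs))"
  by (intro total_recursive_cov_rec assms; unfold attr_step_def)
    (intro total_recursive_intros; simp)

lemma cov_rec_attr:
  "cov_rec attr_step X (expr_encode e) =
     prod_encode (bform_encode (attr_out X e), bform_encode (attr_wt X e))"
  by (induction e; simp only: expr_encode.simps; subst cov_rec_def; subst attr_step_def;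
      simp add: lookup_prod_encode cov_rec_list_member; auto)

section \<open>The components of the type formula on codes\<close>

definition out_code :: "nat \<Rightarrow> nat \<Rightarrow> nat" where
  "out_code n X = fst (prod_decode (cov_rec attr_step X n))"

definition wt_code :: "nat \<Rightarrow> nat \<Rightarrow> nat" where
  "wt_code n X = snd (prod_decode (cov_rec attr_step X n))"

lemma out_code_expr_encode: "out_code (expr_encode e) X = bform_encode (attr_out X e)"
  by (simp add: out_code_def cov_rec_attr)

lemma wt_code_expr_encode: "wt_code (expr_encode e) X = bform_encode (attr_wt X e)"
  by (simp add: wt_code_def cov_rec_attr)

text \<open>\<open>n\<close> is the code of the expression, so \<open>Suc n\<close> is the sample
  fresh attribute of \<open>principal_formula\<close>.\<close>

definition is_tvar :: "nat \<Rightarrow> nat \<Rightarrow> nat" where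
  "is_tvar n m = cov_rec satisfies_step m (wt_code n (Suc n))"

definition is_outvar :: "nat \<Rightarrow> nat \<Rightarrow> nat" where
  "is_outvar n m =
     (if is_tvar n m = 0 then 0 else cov_rec satisfies_step m (out_code n (Suc n)))"

definition is_declared :: "nat \<Rightarrow> nat \<Rightarrow> nat \<Rightarrow> nat" where
  "is_declared n r m = (if is_tvar n m = 0 then 0 else of_bool (odd (m div 2 ^ r)))"

lemma total_recursive_codes [total_recursive_intros]:
  assumes "total_recursive k f" "total_recursive k g"
  shows "total_recursive k (\<lambda>xs. out_code (f xs) (g xs))"
    and "total_recursive k (\<lambda>xs. wt_code (f xs) (g xs))"
  unfolding out_code_def wt_code_def by (intro total_recursive_intros assms)+

lemma total_recursive_is_tvar [total_recursive_intros]: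
  assumes "total_recursive k f" "total_recursive k g"
  shows "total_recursive k (\<lambda>xs. is_tvar (f xs) (g xs))"
  unfolding is_tvar_def by (intro total_recursive_intros assms)

lemma total_recursive_is_outvar [total_recursive_intros]:
  assumes "total_recursive k f" "total_recursive k g"
  shows "total_recursive k (\<lambda>xs. is_outvar (f xs) (g xs))"
  unfolding is_outvar_def by (intro total_recursive_intros assms)

lemma total_recursive_is_declared [total_recursive_intros]:
  assumes "total_recursive k f" "total_recursive k g" "total_recursive k h"
  shows "total_recursive k (\<lambda>xs. is_declared (f xs) (g xs) (h xs))"
  unfolding is_declared_def by (intro total_recursive_intros assms)

text \<open>Exhaustive search suffices: names in the expression are at most its code
  \<open>n\<close>, so masks of relation variables lie below \<open>2 ^ Suc n\<close>.\<close>

definition tvars_code :: "nat \<Rightarrow> nat" where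
  "tvars_code n =
     rec_nat 0 (\<lambda>m y. if is_tvar n m = 0 then y else Suc (prod_encode (m, y))) (2 ^ Suc n)"

definition outvars_code :: "nat \<Rightarrow> nat" where
  "outvars_code n =
     rec_nat 0 (\<lambda>m y. if is_outvar n m = 0 then y else Suc (prod_encode (m, y))) (2 ^ Suc n)"

definition decl_code :: "nat \<Rightarrow> nat \<Rightarrow> nat" where
  "decl_code n r =
     rec_nat 0 (\<lambda>m y. if is_declared n r m = 0 then y else Suc (prod_encode (m, y))) (2 ^ Suc n)"

definition decls_code :: "nat \<Rightarrow> nat" where
  "decls_code n =
     rec_nat 0 (\<lambda>r y. if cov_rec occurs_step r n = 0 then y
       else Suc (prod_encode (prod_encode (r, decl_code n r), y))) (Suc n)"

text \<open>The vacuous test \<open>Suc 0 = 0\<close> gives the recursion the shape of \<open>rec_nat_list_encode\<close>.\<close>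

definition specattrs_code :: "nat \<Rightarrow> nat" where
  "specattrs_code n =
     rec_nat 0 (\<lambda>A y. if Suc 0 = 0 then y
       else Suc (prod_encode (prod_encode (A, prod_encode (wt_code n A, out_code n A)), y))) (Suc n)"

lemma total_recursive_decl_code [total_recursive_intros]:
  assumes "total_recursive k f" "total_recursive k g"
  shows "total_recursive k (\<lambda>xs. decl_code (f xs) (g xs))"
proof (rule total_recursive_compose2[OF _ assms])
  show "total_recursive 2 (\<lambda>xs. decl_code (xs ! 0) (xs ! 1))"
    unfolding decl_code_def by (intro total_recursive_intros; simp)
qed

lemma total_recursive_list_codes:
  "total_recursive 1 (\<lambda>xs. tvars_code (xs ! 0))" "total_recursive 1 (\<lambda>xs. outvars_code (xs ! 0))"
  "total_recursive 1 (\<lambda>xs. decls_code (xs ! 0))" "total_recursive 1 (\<lambda>xs. specattrs_code (xs ! 0))"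
  unfolding tvars_code_def outvars_code_def decls_code_def specattrs_code_def
  by (intro total_recursive_intros; simp)+

definition principal_code :: "nat \<Rightarrow> nat" where
  "principal_code n =
     list_encode [decls_code n, tvars_code n, specattrs_code n, n, outvars_code n]"

lemma total_recursive_principal_code: "total_recursive 1 (\<lambda>xs. principal_code (xs ! 0))"
  unfolding principal_code_def list_encode.simps
  by (intro total_recursive_intros total_recursive_list_codes) simp

lemma represents_principal_code: "represents (principal_code (expr_encode e)) (principal_formula e)"
proof -
  let ?n = "expr_encode e"
  \<comment> \<open>The listings run downwards, as \<open>rec_nat_list_encode\<close> produces
    them.\<close>
  let ?masks = "rev [0..<2 ^ Suc ?n]" and ?names = "rev [0..<Suc ?n]"
  let ?decl = "\<lambda>r. filter (\<lambda>m. is_declared ?n r m \<noteq> 0) ?masks"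
  let ?ds = "map (\<lambda>r. (r, ?decl r)) (filter (\<lambda>r. cov_rec occurs_step r ?n \<noteq> 0) ?names)"
  let ?ts = "filter (\<lambda>m. is_tvar ?n m \<noteq> 0) ?masks"
  let ?ss = "map (\<lambda>A. (A, attr_wt A e, attr_out A e)) ?names"
  let ?os = "filter (\<lambda>m. is_outvar ?n m \<noteq> 0) ?masks"
  have decl: "decl_code ?n r = list_encode (?decl r)" for r
    unfolding decl_code_def by (subst rec_nat_list_encode) simp
  have ds: "decls_code ?n = list_encode (map (\<lambda>(r, as). prod_encode (r, list_encode as)) ?ds)"
    unfolding decls_code_def by (subst rec_nat_list_encode) (simp only: decl map_map o_def prod.case)
  have ts: "tvars_code ?n = list_encode ?ts" and os: "outvars_code ?n = list_encode ?os"
    unfolding tvars_code_def outvars_code_def by (subst rec_nat_list_encode; simp)+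
  have ss: "specattrs_code ?n = list_encode (map (\<lambda>(A, p, q).
      prod_encode (A, prod_encode (bform_encode p, bform_encode q))) ?ss)"
    unfolding specattrs_code_def
    by (subst rec_nat_list_encode)
      (simp add: out_code_expr_encode wt_code_expr_encode o_def del: upt_Suc)
  have is_tvar: "is_tvar ?n m \<noteq> 0 \<longleftrightarrow> satisfies (set_decode m) (attr_wt (Suc ?n) e)" for m
    by (simp add: is_tvar_def wt_code_expr_encode cov_rec_satisfies)
  have set_ts: "principal_tvars e = set ?ts"
    using is_tvar by (auto simp: principal_tvars_def)
  have set_os: "set ?os = {m \<in> principal_tvars e. satisfies (set_decode m) (attr_out (Suc ?n) e)}"
    by (auto simp: set_ts is_outvar_def out_code_expr_encode cov_rec_satisfies simp del: upt_Suc)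
  have set_decl: "set (?decl r) = {m \<in> principal_tvars e. r \<in> set_decode m}" for r
    by (auto simp: set_ts is_declared_def set_decode_def simp del: upt_Suc)
  let ?\<Gamma> = "context_of (principal_formula e)"
  show ?thesis
    unfolding represents_def
  proof (rule exI[of _ ?ds], rule exI[of _ ?ts], rule exI[of _ ?ss], rule exI[of _ ?os],
      intro conjI)
    show "principal_code ?n = list_encode
        [list_encode (map (\<lambda>(r, as). prod_encode (r, list_encode as)) ?ds), list_encode ?ts,
         list_encode (map (\<lambda>(A, p, q).
           prod_encode (A, prod_encode (bform_encode p, bform_encode q))) ?ss),
         expr_encode (expr_of (principal_formula e)), list_encode ?os]"
      unfolding principal_code_def ds ts ss os by (simp add: principal_formula_def)
    show "Relvars ?\<Gamma> = fst ` set ?ds"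
      using expr_relvars_le_encode
      by (auto simp: principal_formula_def cov_rec_occurs image_image less_Suc_eq_le
          simp del: upt_Suc)
    show "\<forall>(r, as)\<in>set ?ds. decl ?\<Gamma> r = set as"
      using set_decl by (simp add: principal_formula_def del: set_filter upt_Suc)
    show "Typevars ?\<Gamma> = set ?ts"
      using set_ts by (simp add: principal_formula_def del: set_filter upt_Suc)
    show "Specattrs ?\<Gamma> = fst ` set ?ss"
      by (auto simp: principal_formula_def image_image less_Suc_eq_le simp del: upt_Suc)
    show "\<forall>(A, p, q)\<in>set ?ss. constraint ?\<Gamma> A = p \<and> outatt (principal_formula e) A = q"
      by (simp add: principal_formula_def del: upt_Suc)
    show "Outvars (principal_formula e) = set ?os"
      using set_os by (simp add: principal_formula_def del: set_filter upt_Suc)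
  qed
qed

theorem theorem1:
  "\<exists>F :: expr \<Rightarrow> type_formula.
     (\<forall>e. principal_for (F e) e) \<and> effectively_computable F"
proof (intro exI conjI allI)
  show "principal_for (principal_formula e) e" for e
    by (rule principal_for_principal_formula)
  obtain p where p: "\<And>xs. length xs = 1 \<Longrightarrow> recf_eval p xs (principal_code (xs ! 0))"
    using total_recursive_principal_code unfolding total_recursive_def by blast
  have "recf_eval p [expr_encode e] (principal_code (expr_encode e))" for e
    using p[of "[expr_encode e]"] by simp
  then show "effectively_computable principal_formula"
    unfolding effectively_computable_def using represents_principal_code by blast
qed

end
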